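(* Let $B$ be a unital $C^*$-algebra and let $a,b\in B$ with $a$ normal. If $\sigma([b,x])\subseteq\sigma([a,x])$ for all $x\in B$, then $b\in\{a\}''$, where $\{a\}''$ is the bicommutant of $\{a\}$ in $B$.
   Context: $\sigma(x)$ denotes the spectrum of $x$ in $B$ and $[u,v]=uv-vu$. For a subset $S\subseteq B$, $S'=\{y\in B: ys=sy \text{ for all } s\in S\}$ is the (relative) commutant in $B$ and $S''=(S')'$ is the (relative) bicommutant in $B$. *)

theory Defs
  imports "HOL-Analysis.Analysis"
begin

text \<open>
  Unital complex Banach algebras and unital \<open>C\<^sup>*\<close>-algebras as type classes over the library's
  real Banach algebras. The complex scalar multiplication extends the real one. As in
  \<^class>\<open>real_normed_algebra_1\<close>, the algebra is nonzero and the unit has norm 1; in a nonzero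
  unital \<open>C\<^sup>*\<close>-algebra the latter follows from the \<open>C\<^sup>*\<close>-identity.
\<close>

class complex_banach_algebra_1 = real_normed_algebra_1 + banach +
  fixes scaleC :: "complex \<Rightarrow> 'a \<Rightarrow> 'a"  (infixr \<open>*\<^sub>C\<close> 75)
  assumes scaleC_add_right: "c *\<^sub>C (x + y) = c *\<^sub>C x + c *\<^sub>C y"
    and scaleC_add_left: "(c + d) *\<^sub>C x = c *\<^sub>C x + d *\<^sub>C x"
    and scaleC_scaleC: "c *\<^sub>C d *\<^sub>C x = (c * d) *\<^sub>C x"
    and scaleR_scaleC: "r *\<^sub>R x = complex_of_real r *\<^sub>C x"
    and mult_scaleC_left: "(c *\<^sub>C x) * y = c *\<^sub>C (x * y)"
    and mult_scaleC_right: "x * (c *\<^sub>C y) = c *\<^sub>C (x * y)"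
    and norm_scaleC: "norm (c *\<^sub>C x) = cmod c * norm x"

class cstar_algebra_1 = complex_banach_algebra_1 +
  fixes star :: "'a \<Rightarrow> 'a"
  assumes star_star: "star (star x) = x"
    and star_add: "star (x + y) = star x + star y"
    and star_scaleC: "star (c *\<^sub>C x) = cnj c *\<^sub>C star x"
    and star_mult: "star (x * y) = star y * star x"
    and cstar_identity: "norm (star x * x) = (norm x)\<^sup>2"

instantiation complex :: cstar_algebra_1
begin

definition scaleC_complex :: "complex \<Rightarrow> complex \<Rightarrow> complex"
  where "scaleC_complex = (*)"

definition star_complex :: "complex \<Rightarrow> complex"
  where "star_complex = cnj"

instance
  by standard
    (simp_all add: scaleC_complex_def star_complex_def algebra_simps norm_mult power2_eq_square
      scaleR_conv_of_real)

end

definition normal_element :: "'a::cstar_algebra_1 \<Rightarrow> bool"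
  where "normal_element x \<longleftrightarrow> star x * x = x * star x"

definition invertible_element :: "'a::monoid_mult \<Rightarrow> bool"
  where "invertible_element x \<longleftrightarrow> (\<exists>y. x * y = 1 \<and> y * x = 1)"

definition spectrum :: "'a::complex_banach_algebra_1 \<Rightarrow> complex set"
  where "spectrum x = {c. \<not> invertible_element (c *\<^sub>C 1 - x)}"

definition commutator :: "'a::ring \<Rightarrow> 'a \<Rightarrow> 'a"
  where "commutator u v = u * v - v * u"

definition commutant :: "'a::semigroup_mult set \<Rightarrow> 'a set"
  where "commutant S = {y. \<forall>s\<in>S. y * s = s * y}"

definition bicommutant :: "'a::semigroup_mult set \<Rightarrow> 'a set"
  where "bicommutant S = commutant (commutant S)"

end

theory Submission
  imports Defs "HOL-Computational_Algebra.Fundamental_Theorem_Algebra"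
begin

text \<open>
  Let \<open>f, g\<close> commute with \<open>a\<close> and \<open>g f = 0\<close>. For every \<open>y\<close> and \<open>v = f y g\<close> the commutator \<open>[a, v]\<close>
  squares to zero, so \<open>[b, v]\<close> is quasinilpotent; for \<open>y = (g b f)\<^sup>*\<close> this forces the positive element
  \<open>(g b f) (g b f)\<^sup>*\<close> to be quasinilpotent, whence \<open>g b f = 0\<close>. Apply this to continuous functions of
  a self-adjoint \<open>h\<close> commuting with \<open>a\<close>: it gives \<open>norm [\<phi>(h), b] \<le> norm [\<bar>\<phi>\<bar>(h), b]\<close> for every
  continuous real \<open>\<phi>\<close>. Replacing \<open>\<phi>\<close> by \<open>\<bar>\<phi>\<bar> - K / 2\<close>, where \<open>K\<close> bounds \<open>\<bar>\<phi>\<bar>\<close>, halves the bound on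
  the function and does not decrease the norm of the commutator, so by iteration \<open>[h, b] = 0\<close>. By
  Fuglede's theorem the commutant of \<open>a\<close> is spanned by its self-adjoint elements.
\<close>

subsection \<open>Invertibility and spectrum\<close>

lemma scaleC_one [simp]: "1 *\<^sub>C (x::'a::complex_banach_algebra_1) = x"
  using scaleR_scaleC[of 1 x] by simp

lemma scaleC_zero_left [simp]: "0 *\<^sub>C (x::'a::complex_banach_algebra_1) = 0"
  using scaleR_scaleC[of 0 x] by simp

lemma scaleC_zero_right [simp]: "c *\<^sub>C (0::'a::complex_banach_algebra_1) = 0"
  using scaleC_add_right[of c 0 "0::'a"] by simp

lemma scaleC_minus_right [simp]: "c *\<^sub>C (- x) = - (c *\<^sub>C (x::'a::complex_banach_algebra_1))"
  using scaleC_add_right[of c x "- x"] by (simp add: eq_neg_iff_add_eq_0 add.commute)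

lemma scaleC_minus_left [simp]: "(- c) *\<^sub>C x = - (c *\<^sub>C (x::'a::complex_banach_algebra_1))"
  using scaleC_add_left[of c "- c" x] by (simp add: eq_neg_iff_add_eq_0 add.commute)

lemma scaleC_diff_right: "c *\<^sub>C (x - y) = c *\<^sub>C x - c *\<^sub>C (y::'a::complex_banach_algebra_1)"
  using scaleC_add_right[of c x "- y"] by simp

lemma scaleC_diff_left: "(c - d) *\<^sub>C x = c *\<^sub>C x - d *\<^sub>C (x::'a::complex_banach_algebra_1)"
  using scaleC_add_left[of c "- d" x] by simp

lemma scaleC_sum_right: "c *\<^sub>C (\<Sum>i\<in>A. f i) = (\<Sum>i\<in>A. c *\<^sub>C (f i::'a::complex_banach_algebra_1))"
  by (induction A rule: infinite_finite_induct) (auto simp: scaleC_add_right)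

lemma scaleC_sum_left: "(\<Sum>i\<in>A. f i) *\<^sub>C (x::'a::complex_banach_algebra_1) = (\<Sum>i\<in>A. f i *\<^sub>C x)"
  by (induction A rule: infinite_finite_induct) (auto simp: scaleC_add_left)

lemma scaleC_power: "(c *\<^sub>C (x::'a::complex_banach_algebra_1)) ^ n = (c ^ n) *\<^sub>C (x ^ n)"
  by (induction n) (auto simp: mult_scaleC_left mult_scaleC_right scaleC_scaleC mult.commute)

lemma norm_commutator_le:
  "norm (commutator x y) \<le> 2 * norm x * norm (y::'a::real_normed_algebra)"
proof -
  have "norm (commutator x y) \<le> norm (x * y) + norm (y * x)"
    unfolding commutator_def by (rule norm_triangle_ineq4)
  also have "\<dots> \<le> norm x * norm y + norm y * norm x"
    by (intro add_mono norm_mult_ineq)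
  finally show ?thesis by simp
qed

lemma commutator_diff_left: "commutator (x - y) z = commutator x z - commutator y (z::'a::ring)"
  by (simp add: commutator_def algebra_simps)

lemma one_minus_mult_sum_power:
  "(1 - x) * (\<Sum>k<n. x ^ k) = 1 - (x::'a::ring_1) ^ n"
proof (induction n)
  case (Suc n)
  then show ?case by (simp add: distrib_left) (simp add: algebra_simps)
qed simp

lemma sum_power_mult_one_minus:
  "(\<Sum>k<n. x ^ k) * (1 - x) = 1 - (x::'a::ring_1) ^ n"
proof (induction n)
  case (Suc n)
  then show ?case by (simp add: distrib_right) (simp add: algebra_simps power_commutes)
qed simp

text \<open>The Neumann series converges absolutely, and its partial sums telescope against
  \<open>1 - x\<close> from either side.\<close>

lemma invertible_element_one_minus:
  fixes x :: "'a::{real_normed_algebra_1,banach}"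
  assumes "norm x < 1"
  shows "invertible_element (1 - x)"
proof -
  have "summable (\<lambda>n. x ^ n)"
    by (rule summable_comparison_test[of _ "\<lambda>n. norm x ^ n"])
       (use assms in \<open>auto intro: norm_power_ineq summable_geometric\<close>)
  then have lim: "(\<lambda>n. \<Sum>k<n. x ^ k) \<longlonglongrightarrow> (\<Sum>k. x ^ k)"
    by (rule summable_LIMSEQ)
  have "(\<lambda>n. norm x ^ n) \<longlonglongrightarrow> 0"
    using assms by (intro LIMSEQ_power_zero) auto
  then have "(\<lambda>n. x ^ n) \<longlonglongrightarrow> 0"
    by (rule Lim_null_comparison[rotated]) (auto intro: norm_power_ineq always_eventually)
  then have one: "(\<lambda>n. 1 - x ^ n) \<longlonglongrightarrow> 1"
    using tendsto_diff[OF tendsto_const[of "1::'a"]] by fastforce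
  have "(\<lambda>n. (1 - x) * (\<Sum>k<n. x ^ k)) \<longlonglongrightarrow> (1 - x) * (\<Sum>k. x ^ k)"
       "(\<lambda>n. (\<Sum>k<n. x ^ k) * (1 - x)) \<longlonglongrightarrow> (\<Sum>k. x ^ k) * (1 - x)"
    by (intro tendsto_mult tendsto_const lim)+
  with one show ?thesis
    unfolding invertible_element_def one_minus_mult_sum_power sum_power_mult_one_minus
    by (metis LIMSEQ_unique)
qed

lemma invertible_element_mult:
  assumes "invertible_element x" "invertible_element y"
  shows "invertible_element (x * y)"
proof -
  from assms obtain x' y' where xy: "x * x' = 1" "x' * x = 1" "y * y' = 1" "y' * y = 1"
    unfolding invertible_element_def by blast
  then have "x * y * (y' * x') = 1" "y' * x' * (x * y) = 1"
    by (metis mult.assoc mult.right_neutral)+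
  then show ?thesis unfolding invertible_element_def by blast
qed

lemma invertible_element_scaleC_one:
  assumes "c \<noteq> 0"
  shows "invertible_element (c *\<^sub>C (1::'a::complex_banach_algebra_1))"
  unfolding invertible_element_def
  using assms by (intro exI[of _ "inverse c *\<^sub>C 1"]) (auto simp: mult_scaleC_left scaleC_scaleC)

lemma invertible_element_scaleC:
  assumes "c \<noteq> 0" "invertible_element (x::'a::complex_banach_algebra_1)"
  shows "invertible_element (c *\<^sub>C x)"
  using invertible_element_mult[OF invertible_element_scaleC_one[OF assms(1)] assms(2)]
  by (simp add: mult_scaleC_left)

text \<open>Scaling by \<open>c\<close> lets resolvents be studied in the variable
  \<open>s = inverse c\<close>, where a disc about 0 corresponds to large \<open>c\<close>.\<close>

lemma not_in_spectrum_iff_one_minus: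
  fixes x :: "'a::complex_banach_algebra_1"
  assumes "c \<noteq> 0"
  shows "c \<notin> spectrum x \<longleftrightarrow> invertible_element (1 - inverse c *\<^sub>C x)"
proof
  assume "c \<notin> spectrum x"
  then have "invertible_element (inverse c *\<^sub>C (c *\<^sub>C 1 - x))"
    using assms by (intro invertible_element_scaleC) (auto simp: spectrum_def)
  then show "invertible_element (1 - inverse c *\<^sub>C x)"
    using assms by (simp add: scaleC_diff_right scaleC_scaleC)
next
  assume "invertible_element (1 - inverse c *\<^sub>C x)"
  then have "invertible_element (c *\<^sub>C (1 - inverse c *\<^sub>C x))"
    using assms by (intro invertible_element_scaleC)
  then show "c \<notin> spectrum x"
    using assms by (simp add: scaleC_diff_right scaleC_scaleC spectrum_def)
qed

lemma norm_le_of_in_spectrum: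
  fixes x :: "'a::complex_banach_algebra_1"
  assumes "c \<in> spectrum x"
  shows "cmod c \<le> norm x"
proof (rule ccontr)
  assume "\<not> cmod c \<le> norm x"
  then have lt: "norm x < cmod c" by simp
  then have c: "c \<noteq> 0" by auto
  have "norm (inverse c *\<^sub>C x) < 1"
    using lt c by (simp add: norm_scaleC norm_inverse norm_divide divide_simps)
  from invertible_element_one_minus[OF this] show False
    using not_in_spectrum_iff_one_minus[OF c, of x] assms by simp
qed

lemma spectrum_square_zero:
  fixes x :: "'a::complex_banach_algebra_1"
  assumes "x * x = 0"
  shows "spectrum x \<subseteq> {0}"
proof
  fix c assume "c \<in> spectrum x"
  moreover have "invertible_element (1 - inverse c *\<^sub>C x)"
    unfolding invertible_element_def using assms
    by (intro exI[of _ "1 + inverse c *\<^sub>C x"])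
       (simp add: algebra_simps mult_scaleC_left mult_scaleC_right)
  ultimately show "c \<in> {0}"
    using not_in_spectrum_iff_one_minus[of c x] by auto
qed

text \<open>For \<open>N\<close> not dividing \<open>m\<close>, \<open>w ^ m\<close> is an N-th root
  of unity other than 1, so the geometric sum vanishes. These sums stand in for contour
  integrals.\<close>

lemma sum_power_root_of_unity:
  fixes N m :: nat
  assumes "N > 0"
  defines "w \<equiv> exp (2 * of_real pi * \<i> * of_nat 1 / of_nat N)"
  shows "(\<Sum>j<N. (w ^ j) ^ m) = (if N dvd m then of_nat N else 0)"
proof -
  have wm: "w ^ m = exp (2 * of_real pi * \<i> * of_nat m / of_nat N)" for m
    by (simp add: w_def exp_of_nat_mult[symmetric] mult_ac)
  have one: "w ^ m = 1 \<longleftrightarrow> N dvd m" for m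
    unfolding wm using assms complex_root_unity_eq_1[of N m] by simp
  have "(\<Sum>j<N. (w ^ j) ^ m) = (\<Sum>j<N. (w ^ m) ^ j)"
    by (simp add: power_mult[symmetric] mult.commute)
  also have "\<dots> = (if N dvd m then of_nat N else 0)"
  proof (cases "N dvd m")
    case False
    have "(w ^ m) ^ N = 1"
      using one[of N] by (metis dvd_refl power_commuting_commutes power_mult mult.commute power_one)
    then show ?thesis using False by (simp add: sum_gp_strict one)
  next
    case True
    then show ?thesis using one[of m] by simp
  qed
  finally show ?thesis .
qed

text \<open>
  An elementary substitute for Cauchy's formula in the proof of the spectral radius formula.
\<close>

lemma resolvent_average:
  fixes x :: "'a::complex_banach_algebra_1" and F :: "complex \<Rightarrow> 'a" and t :: real and n :: nat
  defines "w \<equiv> exp (2 * of_real pi * \<i> * of_nat 1 / of_nat n)"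
  assumes n: "n > 0"
    and F: "\<And>j. j < n \<Longrightarrow> (1 - (of_real t * w ^ j) *\<^sub>C x) * F (of_real t * w ^ j) = 1"
  defines "G \<equiv> inverse (of_nat n) *\<^sub>R (\<Sum>j<n. F (of_real t * w ^ j))"
  shows "(1 - t ^ n *\<^sub>R x ^ n) * G = 1"
proof -
  have w: "w ^ n = 1"
    using n by (simp add: w_def exp_of_nat_mult[symmetric])
  \<comment> \<open>The point \<open>t w^j\<close> has n-th power \<open>t^n\<close>, so
    \<open>1 - t^n x^n\<close> has the right factor \<open>1 - t w^j x\<close>, which cancels the
    resolvent value.\<close>
  have "(1 - t ^ n *\<^sub>R x ^ n) * F (of_real t * w ^ j)
      = (\<Sum>k<n. (of_real (t ^ k) * (w ^ j) ^ k) *\<^sub>C x ^ k)" if "j < n" for j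
  proof -
    let ?s = "of_real t * w ^ j"
    have "?s ^ n = of_real (t ^ n)"
      using w by (simp add: power_mult_distrib) (metis mult.commute power_mult power_one)
    then have "1 - t ^ n *\<^sub>R x ^ n = 1 - (?s *\<^sub>C x) ^ n"
      by (simp only: scaleC_power scaleR_scaleC)
    also have "\<dots> = (\<Sum>k<n. (?s *\<^sub>C x) ^ k) * (1 - ?s *\<^sub>C x)"
      by (simp only: sum_power_mult_one_minus)
    finally have "(1 - t ^ n *\<^sub>R x ^ n) * F ?s = (\<Sum>k<n. (?s *\<^sub>C x) ^ k)"
      using F[OF that] by (simp add: mult.assoc w_def)
    then show ?thesis by (simp add: scaleC_power power_mult_distrib)
  qed
  then have "(1 - t ^ n *\<^sub>R x ^ n) * (\<Sum>j<n. F (of_real t * w ^ j))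
      = (\<Sum>j<n. \<Sum>k<n. (of_real (t ^ k) * (w ^ j) ^ k) *\<^sub>C x ^ k)"
    by (simp add: sum_distrib_left)
  also have "\<dots> = (\<Sum>k<n. (of_real (t ^ k) * (\<Sum>j<n. (w ^ j) ^ k)) *\<^sub>C x ^ k)"
    by (subst sum.swap) (simp add: sum_distrib_left scaleC_sum_left)
  \<comment> \<open>Averaging over \<open>j\<close> annihilates every power \<open>k\<close> with
    \<open>0 < k < n\<close>.\<close>
  also have "\<dots> = (\<Sum>k<n. if k = 0 then of_nat n *\<^sub>C 1 else 0)"
  proof (rule sum.cong[OF refl])
    fix k assume "k \<in> {..<n}"
    then have "n dvd k \<longleftrightarrow> k = 0" by (auto dest: dvd_imp_le)
    then show "(of_real (t ^ k) * (\<Sum>j<n. (w ^ j) ^ k)) *\<^sub>C x ^ k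
        = (if k = 0 then of_nat n *\<^sub>C 1 else 0)"
      using sum_power_root_of_unity[OF n, of k] by (simp add: w_def)
  qed
  also have "\<dots> = of_nat n *\<^sub>C 1" using n by simp
  finally show ?thesis
    using n by (simp add: G_def scaleR_scaleC scaleC_scaleC mult_scaleC_right)
qed

subsection \<open>Self-adjoint elements\<close>

lemma star_zero [simp]: "star (0::'a::cstar_algebra_1) = 0"
  using star_add[of 0 "0::'a"] by simp

lemma star_minus [simp]: "star (- x) = - star (x::'a::cstar_algebra_1)"
  using star_add[of x "- x"] by (simp add: eq_neg_iff_add_eq_0 add.commute)

lemma star_diff: "star (x - y) = star x - star (y::'a::cstar_algebra_1)"
  using star_add[of x "- y"] by simp

lemma star_one [simp]: "star (1::'a::cstar_algebra_1) = 1"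
  using star_mult[of "star 1" "1::'a"] by (simp add: star_star)

lemma star_power: "star (x ^ n) = star (x::'a::cstar_algebra_1) ^ n"
  by (induction n) (auto simp: star_mult power_commutes)

lemma norm_star [simp]: "norm (star x) = norm (x::'a::cstar_algebra_1)"
proof -
  have le: "norm y \<le> norm (star y)" for y :: 'a
  proof (cases "y = 0")
    case False
    have "norm y * norm y \<le> norm (star y) * norm y"
      using cstar_identity[of y] norm_mult_ineq[of "star y" y] by (simp add: power2_eq_square)
    then show ?thesis using False by simp
  qed simp
  show ?thesis using le[of x] le[of "star x"] by (simp add: star_star)
qed

lemma bounded_linear_star: "bounded_linear (star :: 'a::cstar_algebra_1 \<Rightarrow> 'a)"
  by (rule bounded_linear_intro[of _ 1])
     (auto simp: star_add scaleR_scaleC star_scaleC)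

lemma cstar_identity': "norm (x * star x) = (norm (x::'a::cstar_algebra_1))\<^sup>2"
  using cstar_identity[of "star x"] by (simp add: star_star)

text \<open>The shift \<open>h + i t\<close> has squared norm at most
  \<open>(norm h)^2 + t^2\<close>, while the squared modulus of the shifted spectral point contains
  \<open>t^2\<close> and the cross term \<open>2 t Im c\<close>, which can be made as large as
  desired.\<close>

lemma spectrum_selfadjoint_real:
  fixes h :: "'a::cstar_algebra_1"
  assumes "star h = h" "c \<in> spectrum h"
  shows "Im c = 0"
proof (rule ccontr)
  assume ne: "Im c \<noteq> 0"
  \<comment> \<open>Chosen so that the cross term equals \<open>(norm h)^2 + 1\<close>, just above
    what the norm bound allows.\<close>
  define t where "t = ((norm h)\<^sup>2 + 1) / (2 * Im c)"
  define z where "z = \<i> * of_real t"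
  have "c + z \<in> spectrum (h + z *\<^sub>C 1)"
    using assms(2) by (simp add: spectrum_def scaleC_add_left algebra_simps)
  then have le: "cmod (c + z) \<le> norm (h + z *\<^sub>C 1)"
    by (rule norm_le_of_in_spectrum)
  have "star (h + z *\<^sub>C 1) * (h + z *\<^sub>C 1) = h * h + (t\<^sup>2) *\<^sub>R 1"
    using assms(1)
    by (simp add: star_add star_scaleC z_def algebra_simps mult_scaleC_left mult_scaleC_right
        scaleC_scaleC scaleC_diff_right scaleR_scaleC power2_eq_square)
  then have "(norm (h + z *\<^sub>C 1))\<^sup>2 = norm (h * h + (t\<^sup>2) *\<^sub>R 1)"
    using cstar_identity[of "h + z *\<^sub>C 1"] by simp
  also have "\<dots> \<le> norm (h * h) + t\<^sup>2"
    using norm_triangle_ineq[of "h * h" "(t\<^sup>2) *\<^sub>R 1"] by simp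
  also have "\<dots> \<le> (norm h)\<^sup>2 + t\<^sup>2"
    using norm_mult_ineq[of h h] by (simp add: power2_eq_square)
  finally have "(cmod (c + z))\<^sup>2 \<le> (norm h)\<^sup>2 + t\<^sup>2"
    using power_mono[OF le norm_ge_zero, of 2] by linarith
  then have "(Re c)\<^sup>2 + (Im c)\<^sup>2 + 2 * Im c * t \<le> (norm h)\<^sup>2"
    by (simp add: cmod_power2 z_def power2_sum)
  moreover have "2 * Im c * t = (norm h)\<^sup>2 + 1" using ne by (simp add: t_def)
  ultimately show False using zero_le_power2[of "Re c"] zero_le_power2[of "Im c"] by linarith
qed

lemma norm_selfadjoint_power:
  fixes h :: "'a::cstar_algebra_1"
  assumes "star h = h"
  shows "norm (h ^ (2 ^ k)) = norm h ^ (2 ^ k)"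
proof (induction k)
  case (Suc k)
  have "h ^ (2 ^ Suc k) = star (h ^ (2 ^ k)) * h ^ (2 ^ k)"
    using assms by (simp add: star_power power_add[symmetric] mult_2)
  then show ?case
    using Suc by (simp add: cstar_identity power_mult[symmetric] mult.commute)
qed simp

section \<open>Resolvents and the spectral radius of self-adjoint elements\<close>

lemma resolvent_identity:
  fixes x :: "'a::complex_banach_algebra_1"
  assumes "F s * (1 - s *\<^sub>C x) = 1" "(1 - s' *\<^sub>C x) * F s' = 1"
  shows "F s - F s' = (s - s') *\<^sub>C (F s * x * F s')"
proof -
  have "F s - F s' = F s * ((1 - s' *\<^sub>C x) * F s') - (F s * (1 - s *\<^sub>C x)) * F s'"
    using assms by simp
  also have "\<dots> = F s * ((s - s') *\<^sub>C x) * F s'"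
    by (simp add: algebra_simps scaleC_diff_left)
  finally show ?thesis by (simp add: mult_scaleC_left mult_scaleC_right)
qed

text \<open>The resolvent identity bounds the increment by \<open>cmod (s - s0)\<close> times a
  multiple of \<open>norm (F s)\<close>. Near \<open>s0\<close> this is at most half of
  \<open>norm (F s)\<close>, which gives local boundedness and then continuity.\<close>

lemma continuous_on_resolvent:
  fixes x :: "'a::complex_banach_algebra_1"
  assumes inv: "\<And>s. s \<in> S \<Longrightarrow> (1 - s *\<^sub>C x) * F s = 1 \<and> F s * (1 - s *\<^sub>C x) = 1"
  shows "continuous_on S F"
proof (rule continuous_onI)
  fix s0 and e :: real
  assume s0: "s0 \<in> S" and e: "e > 0"
  define K where "K = norm (F s0) * norm x + 1"
  define L where "L = 2 * norm (F s0) * K + 1"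
  have K: "K > 0" and L: "L > 0" by (auto simp: K_def L_def add_nonneg_pos)
  show "\<exists>d>0. \<forall>s\<in>S. dist s s0 < d \<longrightarrow> dist (F s) (F s0) \<le> e"
  proof (intro exI conjI ballI impI)
    show "min (1 / (2 * K)) (e / L) > 0" using K L e by simp
    fix s assume s: "s \<in> S" and d: "dist s s0 < min (1 / (2 * K)) (e / L)"
    have diff: "norm (F s - F s0) \<le> cmod (s - s0) * (norm (F s) * K)"
    proof -
      have "norm (F s - F s0) = cmod (s - s0) * norm (F s * x * F s0)"
        using resolvent_identity[of F s x s0] inv s s0 by (simp add: norm_scaleC)
      also have "\<dots> \<le> cmod (s - s0) * (norm (F s) * norm x * norm (F s0))"
        by (intro mult_left_mono order.trans[OF norm_mult_ineq] mult_right_mono norm_mult_ineq) auto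
      also have "\<dots> \<le> cmod (s - s0) * (norm (F s) * K)"
        by (intro mult_left_mono) (auto simp: K_def algebra_simps)
      finally show ?thesis .
    qed
    also have "\<dots> = (cmod (s - s0) * K) * norm (F s)" by simp
    also have "\<dots> \<le> (1 / 2) * norm (F s)"
      using d K by (intro mult_right_mono) (auto simp: dist_norm field_simps)
    finally have "norm (F s) \<le> 2 * norm (F s0)"
      using norm_triangle_ineq2[of "F s" "F s0"] by simp
    then have "cmod (s - s0) * (norm (F s) * K) \<le> cmod (s - s0) * L"
      using K by (intro mult_left_mono) (auto simp: L_def intro: add_increasing2 mult_right_mono)
    also have "\<dots> \<le> e"
      using d L by (auto simp: dist_norm field_simps)
    finally show "dist (F s) (F s0) \<le> e" using diff by (simp add: dist_norm)
  qed
qed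

text \<open>
  Suppose the circle of radius \<open>norm h\<close> misses the spectrum. The resolvent averages \<open>G n t\<close>
  then have a modulus of continuity in \<open>t\<close> that is uniform in \<open>n\<close>, and tend to 1 for
  \<open>t < 1 / norm h\<close>; but for \<open>t = 1 / norm h\<close> they stay away from 1 because
  \<open>norm (h ^ n) = norm h ^ n\<close> when \<open>n\<close> is a power of 2.
\<close>

lemma selfadjoint_spectral_radius:
  fixes h :: "'a::cstar_algebra_1"
  assumes sa: "star h = h"
  obtains c where "c \<in> spectrum h" "cmod c = norm h"
proof (cases "h = 0")
  case True
  have "\<not> invertible_element (0::'a)" by (simp add: invertible_element_def)
  then have "0 \<in> spectrum h" using True by (simp add: spectrum_def)
  then show ?thesis using that True by auto
next
  case False
  show ?thesis
  proof (rule ccontr)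
    assume "\<not> thesis"
    then have none: "cmod c \<noteq> norm h" if "c \<in> spectrum h" for c
      using that \<open>\<And>c. c \<in> spectrum h \<Longrightarrow> cmod c = norm h \<Longrightarrow> thesis\<close> by blast
    define t0 where "t0 = 1 / norm h"
    have t0: "t0 > 0" "t0 * norm h = 1" using False by (auto simp: t0_def)
    \<comment> \<open>Apart from \<open>s = 0\<close>, the disc of radius \<open>t0\<close>
      corresponds to \<open>cmod c >= norm h\<close> for \<open>c = inverse s\<close>: the circle is
      free by assumption, and no larger \<open>c\<close> is spectral.\<close>
    have "invertible_element (1 - s *\<^sub>C h)" if "cmod s \<le> t0" for s
    proof (cases "s = 0")
      case True
      then show ?thesis by (auto simp: invertible_element_def)
    next
      case s: False
      have "norm h \<le> cmod (inverse s)"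
        using that s False by (simp add: t0_def norm_inverse norm_divide field_simps)
      then have "inverse s \<notin> spectrum h"
        using none norm_le_of_in_spectrum by force
      then show ?thesis using not_in_spectrum_iff_one_minus[of "inverse s" h] s by simp
    qed
    then obtain F where F: "\<And>s. cmod s \<le> t0 \<Longrightarrow> (1 - s *\<^sub>C h) * F s = 1 \<and> F s * (1 - s *\<^sub>C h) = 1"
      unfolding invertible_element_def by metis
    define D where "D = cball (0::complex) t0"
    have contF: "continuous_on D F"
      by (rule continuous_on_resolvent[of D h]) (use F in \<open>auto simp: D_def\<close>)
    have cD: "compact D" by (simp add: D_def)
    obtain M where M: "\<And>s. s \<in> D \<Longrightarrow> norm (F s) \<le> M"
      using compact_imp_bounded[OF compact_continuous_image[OF contF cD]]
      by (auto simp: bounded_iff)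
    have "0 \<in> D" using t0 by (simp add: D_def)
    from M[OF this] have M0: "M \<ge> 0" using norm_ge_zero order_trans by blast
    \<comment> \<open>Two errors of 1/8 will put \<open>G t0\<close> within 1/4 of 1, against the
      lower bound 1/2 found at the end.\<close>
    obtain d where d: "d > 0" "\<And>s s'. s \<in> D \<Longrightarrow> s' \<in> D \<Longrightarrow> dist s' s < d \<Longrightarrow> dist (F s') (F s) < 1/8"
      using compact_uniformly_continuous[OF contF cD] unfolding uniformly_continuous_on_def
      by (metis zero_less_divide_1_iff zero_less_numeral)
    \<comment> \<open>A radius strictly below \<open>t0\<close> but closer to it than
      \<open>d\<close>; the maximum keeps it nonnegative.\<close>
    define t where "t = max 0 (t0 - d / 2)"
    have t: "0 \<le> t" "t < t0" "t0 - t < d" using t0 d(1) by (auto simp: t_def)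
    define q where "q = t * norm h"
    have q: "0 \<le> q" "q < 1" using t t0 False by (auto simp: q_def t0_def field_simps)
    have "(\<lambda>k. M * q ^ (2 ^ k)) \<longlonglongrightarrow> M * 0"
    proof (intro tendsto_mult tendsto_const)
      have "filterlim (\<lambda>k. 2 ^ k :: nat) at_top sequentially"
        by (rule filterlim_subseq) (auto simp: strict_mono_def)
      then show "(\<lambda>k. q ^ (2 ^ k)) \<longlonglongrightarrow> 0"
        using LIMSEQ_power_zero[of q] q by (auto intro: filterlim_compose)
    qed
    then have "eventually (\<lambda>k. M * q ^ (2 ^ k) < 1/8) sequentially"
      by (rule order_tendstoD) simp
    then obtain k where k: "M * q ^ (2 ^ k) < 1/8"
      by (auto simp: eventually_sequentially)
    define n :: nat where "n = 2 ^ k"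
    have n: "n > 0" by (simp add: n_def)
    define w where "w = exp (2 * of_real pi * \<i> * of_nat 1 / of_nat n)"
    have w: "cmod (w ^ j) = 1" for j
      by (simp add: w_def norm_power norm_exp_eq_Re)
    define G where "G r = inverse (of_nat n) *\<^sub>R (\<Sum>j<n. F (of_real r * w ^ j))" for r :: real
    have GD: "of_real r * w ^ j \<in> D" if "0 \<le> r" "r \<le> t0" for r j
      using that w[of j] by (simp add: D_def norm_mult)
    have G: "(1 - r ^ n *\<^sub>R h ^ n) * G r = 1" if "0 \<le> r" "r \<le> t0" for r
      unfolding G_def w_def
      by (rule resolvent_average[OF n]) (use F GD[OF that] in \<open>auto simp: w_def D_def\<close>)
    have eq: "G r - 1 = (r ^ n *\<^sub>R h ^ n) * G r" if "0 \<le> r" "r \<le> t0" for r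
      using G[OF that] by (simp add: algebra_simps)
    have avg: "norm (inverse (of_nat n) *\<^sub>R (\<Sum>j<n. f j)) \<le> C"
      if "\<And>j. norm (f j) \<le> C" for f :: "nat \<Rightarrow> 'a" and C :: real
    proof -
      have "norm (\<Sum>j<n. f j) \<le> (\<Sum>j<n. C)" using that by (intro sum_norm_le) auto
      then show ?thesis using n by (simp add: field_simps)
    qed
    have "norm (G t - G t0) \<le> 1/8"
    proof -
      have eq': "G t - G t0 = inverse (of_nat n) *\<^sub>R (\<Sum>j<n. F (of_real t * w ^ j) - F (of_real t0 * w ^ j))"
        by (simp add: G_def sum_subtractf scaleR_diff_right)
      have le: "norm (F (of_real t * w ^ j) - F (of_real t0 * w ^ j)) \<le> 1/8" for j
      proof -
        have "dist (of_real t * w ^ j) (of_real t0 * w ^ j) = \<bar>t - t0\<bar> * cmod (w ^ j)"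
          by (simp add: dist_norm left_diff_distrib[symmetric] norm_mult)
             (metis norm_of_real of_real_diff)
        also have "\<dots> < d" using t w[of j] by simp
        finally show ?thesis
          using d(2)[OF GD[of t0 j] GD[of t j]] t t0 by (simp add: dist_norm)
      qed
      show ?thesis unfolding eq' by (rule avg) (rule le)
    qed
    moreover have "norm (G t - 1) \<le> 1/8"
    proof -
      have "norm (G t) \<le> M"
        unfolding G_def using M GD[of t] t by (intro avg) auto
      have "norm (G t - 1) \<le> norm (t ^ n *\<^sub>R h ^ n) * norm (G t)"
        using eq[of t] t norm_mult_ineq[of "t ^ n *\<^sub>R h ^ n" "G t"] by simp
      also have "\<dots> \<le> q ^ n * M"
        using \<open>norm (G t) \<le> M\<close> t q norm_power_ineq[of h n]
        by (intro mult_mono) (auto simp: q_def power_mult_distrib intro: mult_left_mono)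
      finally show ?thesis using k by (simp add: n_def mult.commute)
    qed
    ultimately have "norm (G t0 - 1) \<le> 1/4"
      using norm_triangle_ineq4[of "G t - 1" "G t - G t0"] by simp
    define u where "u = t0 ^ n *\<^sub>R h ^ n"
    have "norm u = 1"
      using norm_selfadjoint_power[OF sa, of k] t0
      by (simp add: u_def n_def power_mult_distrib[symmetric])
    \<comment> \<open>This is \<open>G t0 - 1 = u * G t0\<close> solved for \<open>u\<close>: if
      \<open>G t0\<close> is near 1, then \<open>u\<close> must be small.\<close>
    have "u = (G t0 - 1) - u * (G t0 - 1)"
      using eq[of t0] t0 unfolding u_def[symmetric] by (simp add: algebra_simps)
    then have "norm u \<le> norm (G t0 - 1) + norm (u * (G t0 - 1))"
      by (metis norm_triangle_ineq4)
    also have "\<dots> \<le> norm (G t0 - 1) + norm u * norm (G t0 - 1)"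
      by (intro add_left_mono norm_mult_ineq)
    finally have "1 \<le> 2 * norm (G t0 - 1)" using \<open>norm u = 1\<close> by simp
    with \<open>norm (G t0 - 1) \<le> 1/4\<close> show False by simp
  qed
qed

subsection \<open>Continuous functional calculus\<close>

definition peval :: "complex poly \<Rightarrow> 'a \<Rightarrow> 'a::complex_banach_algebra_1"
  where "peval p x = fold_coeffs (\<lambda>c y. c *\<^sub>C 1 + x * y) p 0"

lemma peval_0 [simp]: "peval 0 x = 0"
  by (simp add: peval_def)

lemma peval_pCons [simp]: "peval (pCons c p) x = c *\<^sub>C 1 + x * peval p x"
  by (cases "p = 0 \<and> c = 0") (auto simp: peval_def)

lemma peval_add: "peval (p + q) x = peval p x + peval q x"
  by (induction p q rule: poly_induct2) (auto simp: scaleC_add_left algebra_simps)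

lemma peval_smult: "peval (smult c p) x = c *\<^sub>C peval p x"
  by (induction p) (auto simp: scaleC_add_right scaleC_scaleC mult_scaleC_right)

lemma peval_diff: "peval (p - q) x = peval p x - peval q x"
  using peval_add[of "p - q" q x] by (simp add: algebra_simps)

lemma peval_mult: "peval (p * q) x = peval p x * peval q x"
  by (induction p) (auto simp: peval_add peval_smult algebra_simps mult_scaleC_left)

lemma peval_commute:
  assumes "y * x = x * y"
  shows "y * peval p x = peval p x * y"
proof (induction p)
  case (pCons c p)
  have "y * (x * peval p x) = x * (y * peval p x)"
    using assms by (metis mult.assoc)
  then show ?case
    using pCons by (simp add: algebra_simps mult_scaleC_left mult_scaleC_right)
qed simp

lemma star_peval: "star (peval p x) = peval (map_poly cnj p) (star (x::'a::cstar_algebra_1))"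
proof (induction p)
  case (pCons c p)
  have "peval p x * x = x * peval p x"
    by (rule peval_commute[symmetric]) simp
  then have "star (x * peval p x) = star x * star (peval p x)"
    by (metis star_mult)
  then show ?case using pCons by (simp add: map_poly_pCons star_add star_scaleC)
qed simp

lemma poly_map_cnj_of_real: "poly (map_poly cnj p) (of_real t) = cnj (poly p (of_real t))"
  by (induction p) (auto simp: map_poly_pCons)

text \<open>Induction on the degree: the fundamental theorem of algebra splits off a linear factor
  at a root, and a root outside the spectrum makes that factor invertible.\<close>

lemma invertible_element_peval:
  fixes x :: "'a::complex_banach_algebra_1"
  assumes "p \<noteq> 0" "\<And>z. z \<in> spectrum x \<Longrightarrow> poly p z \<noteq> 0"
  shows "invertible_element (peval p x)"
  using assms
proof (induction "degree p" arbitrary: p)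
  case 0
  then obtain c where "p = [:c:]" using degree_eq_zeroE by metis
  then show ?case using 0 by (auto intro: invertible_element_scaleC_one)
next
  case (Suc n)
  then have "\<not> constant (poly p)" by (simp add: constant_degree)
  then obtain z where z: "poly p z = 0" using fundamental_theorem_of_algebra by blast
  then obtain q' where "p = [:- z, 1:] * q'"
    unfolding poly_eq_0_iff_dvd by (elim dvdE)
  \<comment> \<open>The sign moves to the cofactor so that the linear factor evaluates to
    \<open>z - x\<close>, as in the definition of the spectrum.\<close>
  also have "\<dots> = [:z, - 1:] * (- q')" by simp
  finally obtain q where q: "p = [:z, - 1:] * q" ..
  have "q \<noteq> 0" using q Suc.prems by auto
  then have "degree p = degree q + 1" unfolding q by (subst degree_mult_eq) auto
  then have "invertible_element (peval q x)"
    using Suc.prems \<open>q \<noteq> 0\<close> Suc.hyps(2) by (intro Suc.hyps(1)) (auto simp: q)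
  moreover have "invertible_element (peval [:z, -1:] x)"
    using Suc.prems(2)[of z] z by (auto simp: spectrum_def)
  ultimately show ?case by (simp only: q peval_mult invertible_element_mult)
qed

text \<open>Invertibility fails for the polynomial \<open>c - p\<close>. If that polynomial is zero,
  \<open>p\<close> is constantly \<open>c\<close> and any spectral point serves; this is where
  nonemptiness enters.\<close>

lemma spectrum_peval:
  fixes x :: "'a::complex_banach_algebra_1"
  assumes c: "c \<in> spectrum (peval p x)" and ne: "spectrum x \<noteq> {}"
  obtains z where "z \<in> spectrum x" "c = poly p z"
proof -
  have "peval ([:c:] - p) x = c *\<^sub>C 1 - peval p x"
    by (simp only: peval_diff) simp
  then have "\<not> invertible_element (peval ([:c:] - p) x)"
    using c by (simp add: spectrum_def)
  then have "[:c:] - p = 0 \<or> (\<exists>z\<in>spectrum x. poly ([:c:] - p) z = 0)"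
    using invertible_element_peval by blast
  moreover have "p = [:c:]" if "[:c:] - p = 0" using that by simp
  ultimately show ?thesis using that ne by force
qed

text \<open>The C-star identity reduces to the self-adjoint \<open>q(h)\<close>, whose norm is
  attained at a spectral point. Spectral mapping makes that point \<open>q(t)\<close> with
  \<open>t\<close> real, and \<open>q(t)\<close> is the squared modulus of
  \<open>p(t)\<close>.\<close>

lemma norm_peval_le:
  fixes h :: "'a::cstar_algebra_1"
  assumes sa: "star h = h"
    and K: "\<And>t. \<bar>t\<bar> \<le> norm h \<Longrightarrow> cmod (poly p (of_real t)) \<le> K"
  shows "norm (peval p h) \<le> K"
proof -
  define q where "q = map_poly cnj p * p"
  have eq: "star (peval p h) * peval p h = peval q h"
    using sa by (simp add: star_peval q_def peval_mult)
  then have "star (peval q h) = peval q h"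
    by (metis star_mult star_star)
  then obtain c where c: "c \<in> spectrum (peval q h)" "cmod c = norm (peval q h)"
    using selfadjoint_spectral_radius by blast
  have "spectrum h \<noteq> {}" using selfadjoint_spectral_radius[OF sa] by blast
  with c obtain z where z: "z \<in> spectrum h" "c = poly q z" using spectrum_peval by metis
  define t where "t = Re z"
  have zt: "z = of_real t"
    using spectrum_selfadjoint_real[OF sa z(1)] by (simp add: t_def complex_eq_iff)
  have "\<bar>t\<bar> \<le> norm h" using norm_le_of_in_spectrum[OF z(1)] zt by simp
  then have le: "cmod (poly p (of_real t)) \<le> K" by (rule K)
  have "(norm (peval p h))\<^sup>2 = cmod c" using cstar_identity[of "peval p h"] c(2) eq by simp
  also have "\<dots> = (cmod (poly p (of_real t)))\<^sup>2"
    by (simp add: z(2) zt q_def poly_map_cnj_of_real norm_mult power2_eq_square)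
  also have "\<dots> \<le> K\<^sup>2" using le by (intro power_mono) auto
  finally show ?thesis
    using le norm_ge_zero[of "poly p (of_real t)"] by (meson order_trans power2_le_imp_le)
qed

text \<open>
  The functions live on the interval \<open>{-norm h..norm h}\<close>, which contains the spectrum of \<open>h\<close>.
\<close>

definition is_cfc :: "'a::cstar_algebra_1 \<Rightarrow> (real \<Rightarrow> real) \<Rightarrow> 'a \<Rightarrow> bool"
  where "is_cfc h f x \<longleftrightarrow> (\<exists>P. (\<lambda>n. peval (P n) h) \<longlonglongrightarrow> x \<and>
    uniform_limit {-norm h..norm h} (\<lambda>n t. poly (P n) (of_real t)) (\<lambda>t. complex_of_real (f t)) sequentially)"

text \<open>The choice is sound for self-adjoint \<open>h\<close> and continuous \<open>f\<close>,
  by \<open>is_cfc_exists\<close> and \<open>is_cfc_unique\<close>.\<close>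

definition cfc :: "'a::cstar_algebra_1 \<Rightarrow> (real \<Rightarrow> real) \<Rightarrow> 'a"
  where "cfc h f = (SOME x. is_cfc h f x)"

lemma is_cfc_norm_le:
  fixes h :: "'a::cstar_algebra_1"
  assumes sa: "star h = h" and x: "is_cfc h f x"
    and K: "\<And>t. \<bar>t\<bar> \<le> norm h \<Longrightarrow> \<bar>f t\<bar> \<le> K"
  shows "norm x \<le> K"
proof (rule field_le_epsilon)
  fix e :: real assume e: "e > 0"
  from x obtain P where P: "(\<lambda>n. peval (P n) h) \<longlonglongrightarrow> x"
    "uniform_limit {-norm h..norm h} (\<lambda>n t. poly (P n) (of_real t)) (\<lambda>t. complex_of_real (f t)) sequentially"
    unfolding is_cfc_def by blast
  have "eventually (\<lambda>n. norm (peval (P n) h) \<le> K + e) sequentially"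
    using uniform_limitD[OF P(2) e]
  proof eventually_elim
    case (elim n)
    show ?case
    proof (rule norm_peval_le[OF sa])
      fix t :: real assume t: "\<bar>t\<bar> \<le> norm h"
      then have "t \<in> {-norm h..norm h}" by auto
      with elim have "dist (poly (P n) (of_real t)) (complex_of_real (f t)) < e" by blast
      then show "cmod (poly (P n) (of_real t)) \<le> K + e"
        using K[OF t] norm_triangle_ineq2[of "poly (P n) (of_real t)" "complex_of_real (f t)"]
        by (simp add: dist_norm)
    qed
  qed
  with tendsto_norm[OF P(1)] show "norm x \<le> K + e"
    by (rule tendsto_upperbound) simp
qed

lemma is_cfc_diff:
  assumes "is_cfc h f x" "is_cfc h g y"
  shows "is_cfc h (\<lambda>t. f t - g t) (x - y)"
proof -
  from assms obtain P Q where
    P: "(\<lambda>n. peval (P n) h) \<longlonglongrightarrow> x"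
    "uniform_limit {-norm h..norm h} (\<lambda>n t. poly (P n) (of_real t)) (\<lambda>t. complex_of_real (f t)) sequentially"
    and Q: "(\<lambda>n. peval (Q n) h) \<longlonglongrightarrow> y"
    "uniform_limit {-norm h..norm h} (\<lambda>n t. poly (Q n) (of_real t)) (\<lambda>t. complex_of_real (g t)) sequentially"
    unfolding is_cfc_def by blast
  show ?thesis
    unfolding is_cfc_def
    using tendsto_diff[OF P(1) Q(1)] uniform_limit_minus[OF P(2) Q(2)]
    by (intro exI[of _ "\<lambda>n. P n - Q n"]) (simp add: peval_diff)
qed

lemma is_cfc_mult:
  assumes "is_cfc h f x" "is_cfc h g y"
    and "continuous_on {-norm h..norm h} f" "continuous_on {-norm h..norm h} g"
  shows "is_cfc h (\<lambda>t. f t * g t) (x * y)"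
proof -
  from assms obtain P Q where
    P: "(\<lambda>n. peval (P n) h) \<longlonglongrightarrow> x"
    "uniform_limit {-norm h..norm h} (\<lambda>n t. poly (P n) (of_real t)) (\<lambda>t. complex_of_real (f t)) sequentially"
    and Q: "(\<lambda>n. peval (Q n) h) \<longlonglongrightarrow> y"
    "uniform_limit {-norm h..norm h} (\<lambda>n t. poly (Q n) (of_real t)) (\<lambda>t. complex_of_real (g t)) sequentially"
    unfolding is_cfc_def by blast
  have bd: "bounded ((\<lambda>t. complex_of_real (u t)) ` {-norm h..norm h})"
    if "continuous_on {-norm h..norm h} u" for u
    using that by (intro compact_imp_bounded compact_continuous_image continuous_intros) auto
  show ?thesis
    unfolding is_cfc_def
    using tendsto_mult[OF P(1) Q(1)]
      uniform_lim_mult[OF P(2) Q(2) bd[OF assms(3)] bd[OF assms(4)]]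
    by (intro exI[of _ "\<lambda>n. P n * Q n"]) (simp add: peval_mult)
qed

lemma is_cfc_unique:
  assumes "star h = h" "is_cfc h f x" "is_cfc h f y"
  shows "x = y"
  using is_cfc_norm_le[OF assms(1) is_cfc_diff[OF assms(2,3)], of 0] by simp

lemma real_polynomial_function_poly:
  assumes "real_polynomial_function (g :: real \<Rightarrow> real)"
  obtains p :: "complex poly" where "\<And>t. poly p (of_real t) = of_real (g t)"
proof -
  from assms obtain a n where g: "g = (\<lambda>x. \<Sum>i\<le>n. a i * x ^ i)"
    unfolding real_polynomial_function_iff_sum by blast
  have "poly (\<Sum>i\<le>n. monom (complex_of_real (a i)) i) (of_real t) = of_real (g t)" for t
    by (simp add: g poly_sum poly_monom)
  then show ?thesis using that by blast
qed

text \<open>Weierstrass approximation gives polynomials converging uniformly to \<open>f\<close>;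
  \<open>norm_peval_le\<close> turns this into a Cauchy sequence in the algebra.\<close>

lemma is_cfc_exists:
  fixes h :: "'a::cstar_algebra_1"
  assumes sa: "star h = h" and f: "continuous_on {-norm h..norm h} f"
  shows "\<exists>x. is_cfc h f x"
proof -
  have "\<exists>p::complex poly. \<forall>t\<in>{-norm h..norm h}.
      dist (poly p (of_real t)) (complex_of_real (f t)) < inverse (real (Suc n))" for n
  proof -
    obtain g where g: "real_polynomial_function g"
      "\<And>t. t \<in> {-norm h..norm h} \<Longrightarrow> \<bar>f t - g t\<bar> < inverse (real (Suc n))"
      by (rule Stone_Weierstrass_real_polynomial_function[OF compact_Icc f]) auto
    obtain p :: "complex poly" where "\<And>t. poly p (of_real t) = of_real (g t)"
      using real_polynomial_function_poly[OF g(1)] by blast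
    then show ?thesis
      using g(2) by (intro exI[of _ p]) (auto simp: dist_norm abs_minus_commute norm_of_real simp flip: of_real_diff)
  qed
  then obtain P :: "nat \<Rightarrow> complex poly" where
    P: "\<And>n t. t \<in> {-norm h..norm h} \<Longrightarrow>
      dist (poly (P n) (of_real t)) (complex_of_real (f t)) < inverse (real (Suc n))"
    by metis
  have lim: "uniform_limit {-norm h..norm h} (\<lambda>n t. poly (P n) (of_real t)) (\<lambda>t. complex_of_real (f t)) sequentially"
  proof (rule uniform_limitI)
    fix e :: real assume "e > 0"
    then have "eventually (\<lambda>n. inverse (real (Suc n)) < e) sequentially"
      using LIMSEQ_inverse_real_of_nat order_tendstoD(2) by blast
    then show "\<forall>\<^sub>F n in sequentially. \<forall>t\<in>{-norm h..norm h}.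
        dist (poly (P n) (of_real t)) (complex_of_real (f t)) < e"
      by eventually_elim (use P in \<open>force intro: less_trans\<close>)
  qed
  have "Cauchy (\<lambda>n. peval (P n) h)"
  proof (rule metric_CauchyI)
    fix e :: real assume e: "e > 0"
    then have "e / 3 > 0" by simp
    from uniform_limitD[OF lim this] obtain N where
      N: "\<And>n t. n \<ge> N \<Longrightarrow> t \<in> {-norm h..norm h} \<Longrightarrow>
        dist (poly (P n) (of_real t)) (complex_of_real (f t)) < e / 3"
      unfolding eventually_sequentially by blast
    have "dist (peval (P m) h) (peval (P n) h) < e" if mn: "m \<ge> N" "n \<ge> N" for m n
    proof -
      have "norm (peval (P m - P n) h) \<le> 2 * (e / 3)"
      proof (rule norm_peval_le[OF sa])
        fix t :: real assume t: "\<bar>t\<bar> \<le> norm h"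
        then have "t \<in> {-norm h..norm h}" by auto
        then have "dist (poly (P m) (of_real t)) (poly (P n) (of_real t)) < 2 * (e / 3)"
          using N[OF mn(1), of t] N[OF mn(2), of t]
            dist_triangle2[of "poly (P m) (of_real t)" "poly (P n) (of_real t)" "complex_of_real (f t)"]
          by linarith
        then show "cmod (poly (P m - P n) (of_real t)) \<le> 2 * (e / 3)"
          by (simp add: dist_norm)
      qed
      then show ?thesis using e by (simp add: dist_norm peval_diff)
    qed
    then show "\<exists>N. \<forall>m\<ge>N. \<forall>n\<ge>N. dist (peval (P m) h) (peval (P n) h) < e" by blast
  qed
  then obtain x where "(\<lambda>n. peval (P n) h) \<longlonglongrightarrow> x"
    using Cauchy_convergent convergent_def by blast
  with lim show ?thesis unfolding is_cfc_def by blast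
qed

lemma is_cfc_commute:
  assumes "is_cfc h f x" "y * h = h * y"
  shows "y * x = x * y"
proof -
  from assms(1) obtain P where P: "(\<lambda>n. peval (P n) h) \<longlonglongrightarrow> x"
    unfolding is_cfc_def by blast
  have "(\<lambda>n. y * peval (P n) h) \<longlonglongrightarrow> y * x" "(\<lambda>n. peval (P n) h * y) \<longlonglongrightarrow> x * y"
    by (intro tendsto_mult tendsto_const P)+
  then show ?thesis
    unfolding peval_commute[OF assms(2)] by (rule LIMSEQ_unique)
qed

lemma is_cfc_poly:
  assumes "\<And>t. poly p (of_real t) = of_real (f t)"
  shows "is_cfc h f (peval p h)"
  unfolding is_cfc_def
  by (rule exI[of _ "\<lambda>_. p"]) (simp add: assms uniform_limit_const)

context
  fixes h :: "'a::cstar_algebra_1"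
  assumes sa: "star h = h"
begin

lemma is_cfc_cfc: "continuous_on {-norm h..norm h} f \<Longrightarrow> is_cfc h f (cfc h f)"
  unfolding cfc_def by (rule someI_ex) (rule is_cfc_exists[OF sa])

lemma cfc_eqI:
  assumes "is_cfc h f x"
  shows "cfc h f = x"
  unfolding cfc_def using assms is_cfc_unique[OF sa] by blast

lemma cfc_const: "cfc h (\<lambda>t. c) = of_real c"
  using cfc_eqI[OF is_cfc_poly[of "[:of_real c:]" "\<lambda>_. c"]]
  by (simp add: scaleR_scaleC[symmetric] scaleR_conv_of_real)

lemma cfc_id: "cfc h (\<lambda>t. t) = h"
  using cfc_eqI[OF is_cfc_poly[of "[:0, 1:]" "\<lambda>t. t"]] by simp

lemma cfc_diff:
  assumes "continuous_on {-norm h..norm h} f" "continuous_on {-norm h..norm h} g"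
  shows "cfc h (\<lambda>t. f t - g t) = cfc h f - cfc h g"
  by (intro cfc_eqI is_cfc_diff is_cfc_cfc assms)

lemma cfc_mult:
  assumes "continuous_on {-norm h..norm h} f" "continuous_on {-norm h..norm h} g"
  shows "cfc h (\<lambda>t. f t * g t) = cfc h f * cfc h g"
  by (intro cfc_eqI is_cfc_mult is_cfc_cfc assms)

lemma norm_cfc_le:
  assumes "continuous_on {-norm h..norm h} f" "\<And>t. \<bar>t\<bar> \<le> norm h \<Longrightarrow> \<bar>f t\<bar> \<le> K"
  shows "norm (cfc h f) \<le> K"
  using is_cfc_norm_le[OF sa is_cfc_cfc] assms by blast

lemma cfc_commute:
  assumes "continuous_on {-norm h..norm h} f" "y * h = h * y"
  shows "y * cfc h f = cfc h f * y"
  using is_cfc_commute[OF is_cfc_cfc] assms by blast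

end

subsection \<open>Fuglede's theorem\<close>

text \<open>A discrete Cauchy estimate: weighted sums over roots of unity on the circle of radius
  \<open>R\<close> isolate the linear coefficient up to a small tail, so
  \<open>R * norm (c 1) <= M\<close> for every positive \<open>R\<close>.\<close>

lemma liouville_coefficient:
  fixes c :: "nat \<Rightarrow> 'a::complex_banach_algebra_1"
  assumes sm: "\<And>R. R \<ge> 0 \<Longrightarrow> summable (\<lambda>n. R ^ n * norm (c n))"
    and bd: "\<And>z. norm (\<Sum>n. z ^ n *\<^sub>C c n) \<le> M"
  shows "c 1 = 0"
proof -
  have le: "R * norm (c 1) \<le> M" if R: "R > 0" for R
  proof (rule field_le_epsilon)
    fix e :: real assume e: "e > 0"
    have sR: "summable (\<lambda>n. R ^ n * norm (c n))" using sm R by simp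
    obtain N0 where N0: "\<And>n. n \<ge> N0 \<Longrightarrow> norm (\<Sum>i. R ^ (i + n) * norm (c (i + n))) < e"
      using suminf_exist_split[OF e sR] by blast
    \<comment> \<open>From \<open>N0\<close> on the tail is below \<open>e\<close>; the extra 2 puts
      index 1 below \<open>N\<close>.\<close>
    define N where "N = N0 + 2"
    have N: "N > 0" "N \<ge> 2" by (auto simp: N_def)
    define w where "w = exp (2 * of_real pi * \<i> * of_nat 1 / of_nat N)"
    have w: "cmod w = 1" by (simp add: w_def norm_exp_eq_Re)
    define z where "z j = of_real R * w ^ j" for j
    have z: "cmod (z j) = R" for j using w R by (simp add: z_def norm_mult norm_power)
    have smn: "summable (\<lambda>n. norm (z j ^ n *\<^sub>C c n))" for j
      using sR by (simp add: norm_scaleC norm_power z)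
    define T where "T j = (\<Sum>n. z j ^ (n + N) *\<^sub>C c (n + N))" for j
    have Tle: "norm (T j) \<le> e" for j
    proof -
      have "summable (\<lambda>n. norm (z j ^ (n + N) *\<^sub>C c (n + N)))"
        by (rule summable_ignore_initial_segment[OF smn])
      then have "norm (T j) \<le> (\<Sum>n. norm (z j ^ (n + N) *\<^sub>C c (n + N)))"
        unfolding T_def by (rule summable_norm)
      also have "\<dots> = (\<Sum>n. R ^ (n + N) * norm (c (n + N)))"
        by (simp add: norm_scaleC norm_power z)
      finally show ?thesis using N0[of N] by (simp add: N_def)
    qed
    have split: "(\<Sum>n. z j ^ n *\<^sub>C c n) = T j + (\<Sum>n<N. z j ^ n *\<^sub>C c n)" for j
      unfolding T_def by (rule suminf_split_initial_segment[OF summable_norm_cancel[OF smn]])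
    \<comment> \<open>The weight is the inverse of \<open>w ^ j\<close>, so the sum keeps only
      exponents congruent to 1 modulo \<open>N\<close>.\<close>
    define A where "A f = (\<Sum>j<N. (w ^ j) ^ (N - 1) *\<^sub>C f j)" for f :: "nat \<Rightarrow> 'a"
    have Ale: "norm (A f) \<le> of_nat N * C" if "\<And>j. norm (f j) \<le> C" for f C
    proof -
      have "norm (A f) \<le> (\<Sum>j<N. C)"
        unfolding A_def by (rule sum_norm_le) (simp add: norm_scaleC norm_power w that)
      then show ?thesis by simp
    qed
    have "A (\<lambda>j. \<Sum>n<N. z j ^ n *\<^sub>C c n)
        = (\<Sum>j<N. \<Sum>n<N. (of_real (R ^ n) * (w ^ j) ^ (n + (N - 1))) *\<^sub>C c n)"
      unfolding A_def z_def
      by (simp only: scaleC_sum_right scaleC_scaleC power_mult_distrib power_add of_real_power mult_ac)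
    also have "\<dots> = (\<Sum>n<N. (of_real (R ^ n) * (\<Sum>j<N. (w ^ j) ^ (n + (N - 1)))) *\<^sub>C c n)"
      by (subst sum.swap) (simp add: sum_distrib_left scaleC_sum_left)
    also have "\<dots> = (\<Sum>n<N. if n = 1 then (of_real R * of_nat N) *\<^sub>C c 1 else 0)"
    proof (rule sum.cong[OF refl])
      fix n assume "n \<in> {..<N}"
      then have n: "n < N" by simp
      have "N dvd n + (N - 1) \<longleftrightarrow> n = 1"
      proof
        assume "N dvd n + (N - 1)"
        then obtain q where q: "n + (N - 1) = N * q" by (elim dvdE)
        have "q \<noteq> 0" using q N by (intro notI) simp
        moreover have "q < 2"
        proof (rule ccontr)
          assume "\<not> q < 2"
          then have "N * 2 \<le> N * q" by (intro mult_le_mono2) simp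
          then show False using q n N by linarith
        qed
        ultimately have "q = 1" by simp
        then show "n = 1" using q N by simp
      qed (use N in auto)
      then show "(of_real (R ^ n) * (\<Sum>j<N. (w ^ j) ^ (n + (N - 1)))) *\<^sub>C c n
          = (if n = 1 then (of_real R * of_nat N) *\<^sub>C c 1 else 0)"
        using sum_power_root_of_unity[OF N(1), of "n + (N - 1)"] by (simp add: w_def)
    qed
    also have "\<dots> = (of_real R * of_nat N) *\<^sub>C c 1" using N by simp
    finally have head: "A (\<lambda>j. \<Sum>n<N. z j ^ n *\<^sub>C c n) = (of_real R * of_nat N) *\<^sub>C c 1" .
    have diff: "A (\<lambda>j. \<Sum>n<N. z j ^ n *\<^sub>C c n) = A (\<lambda>j. \<Sum>n. z j ^ n *\<^sub>C c n) - A T"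
      unfolding split by (simp add: A_def scaleC_add_right sum.distrib)
    have "of_nat N * (R * norm (c 1)) = norm ((of_real R * of_nat N) *\<^sub>C c 1)"
      using R by (simp add: norm_scaleC norm_mult)
    also have "\<dots> = norm (A (\<lambda>j. \<Sum>n. z j ^ n *\<^sub>C c n) - A T)"
      by (simp only: head[symmetric] diff)
    also have "\<dots> \<le> norm (A (\<lambda>j. \<Sum>n. z j ^ n *\<^sub>C c n)) + norm (A T)"
      by (rule norm_triangle_ineq4)
    also have "\<dots> \<le> of_nat N * M + of_nat N * e"
      by (intro add_mono Ale bd Tle)
    finally have "of_nat N * (R * norm (c 1)) \<le> of_nat N * (M + e)"
      by (simp add: distrib_left)
    then show "R * norm (c 1) \<le> M + e" using N by simp
  qed
  show ?thesis
  proof (rule ccontr)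
    assume "c 1 \<noteq> 0"
    then have n: "norm (c 1) > 0" by simp
    have "((\<bar>M\<bar> + 1) / norm (c 1)) * norm (c 1) \<le> M"
      by (rule le) (use n in \<open>auto intro!: divide_pos_pos\<close>)
    then show False using n by simp
  qed
qed

lemma star_exp: "star (exp x) = exp (star (x::'a::cstar_algebra_1))"
proof -
  have "(\<lambda>n. star (x ^ n /\<^sub>R fact n)) sums star (exp x)"
    by (intro bounded_linear.sums[OF bounded_linear_star] exp_converges)
  moreover have "star (x ^ n /\<^sub>R fact n) = star x ^ n /\<^sub>R fact n" for n
    by (simp add: scaleR_scaleC star_scaleC star_power)
  ultimately show ?thesis using sums_unique2[OF _ exp_converges[of "star x"]] by simp
qed

lemma exp_commute:
  fixes x y :: "'a::{real_normed_algebra_1,banach}"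
  assumes "y * x = x * y"
  shows "y * exp x = exp x * y"
proof -
  have "y * x ^ n = x ^ n * y" for n
    using assms by (metis power_commuting_commutes)
  then have "(\<lambda>n. y * (x ^ n /\<^sub>R fact n)) = (\<lambda>n. (x ^ n /\<^sub>R fact n) * y)"
    by simp
  moreover have "(\<lambda>n. y * (x ^ n /\<^sub>R fact n)) sums (y * exp x)"
    by (intro sums_mult exp_converges)
  moreover have "(\<lambda>n. (x ^ n /\<^sub>R fact n) * y) sums (exp x * y)"
    by (intro sums_mult2 exp_converges)
  ultimately show ?thesis using sums_unique2 by metis
qed

lemma norm_exp_skew:
  fixes k :: "'a::cstar_algebra_1"
  assumes "star k = - k"
  shows "norm (exp k) = 1"
proof -
  have "(norm (exp k))\<^sup>2 = norm (exp (- k) * exp k)"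
    using cstar_identity[of "exp k"] assms by (simp add: star_exp)
  also have "exp (- k) * exp k = 1"
    using exp_minus_inverse[of "- k"] by simp
  finally show ?thesis using power2_eq_iff_nonneg[of "norm (exp k)" 1] by simp
qed

text \<open>
  The entire function \<open>exp (z a\<^sup>*) y exp (- z a\<^sup>*)\<close> is bounded, since it equals
  \<open>u y u\<^sup>*\<close> for the unitary \<open>u = exp (z a\<^sup>* - cnj z a)\<close>; its linear coefficient is \<open>[a\<^sup>*, y]\<close>.
\<close>

lemma fuglede:
  fixes a y :: "'a::cstar_algebra_1"
  assumes nor: "normal_element a" and y: "a * y = y * a"
  shows "star a * y = y * star a"
proof -
  define w where "w = star a"
  have wa: "w * a = a * w" using nor by (simp add: w_def normal_element_def)
  \<comment> \<open>Cauchy product coefficients of \<open>exp (z w) y exp (- z w)\<close>; in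
    particular \<open>c 1\<close> is \<open>w * y - y * w\<close>.\<close>
  define c where "c n = (\<Sum>i\<le>n. (w ^ i /\<^sub>R fact i * y) * ((- w) ^ (n - i) /\<^sub>R fact (n - i)))" for n
  have cp: "(\<lambda>n. z ^ n *\<^sub>C c n) sums (exp (z *\<^sub>C w) * y * exp (- (z *\<^sub>C w)))" for z
  proof -
    let ?f = "\<lambda>n. ((z *\<^sub>C w) ^ n /\<^sub>R fact n) * y" and ?g = "\<lambda>n. (- (z *\<^sub>C w)) ^ n /\<^sub>R fact n"
    have "summable (\<lambda>n. norm ((z *\<^sub>C w) ^ n /\<^sub>R fact n) * norm y)"
      by (intro summable_mult2 summable_norm_exp)
    then have f: "summable (\<lambda>n. norm (?f n))"
      by (rule summable_comparison_test[rotated]) (auto intro: norm_mult_ineq order_trans)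
    have g: "summable (\<lambda>n. norm (?g n))" by (rule summable_norm_exp)
    have "(\<Sum>n. ?f n) = exp (z *\<^sub>C w) * y" "(\<Sum>n. ?g n) = exp (- (z *\<^sub>C w))"
      using sums_unique[OF sums_mult2[OF exp_converges[of "z *\<^sub>C w"], of y]]
        sums_unique[OF exp_converges[of "- (z *\<^sub>C w)"]] by auto
    then have "(\<lambda>n. \<Sum>i\<le>n. ?f i * ?g (n - i)) sums (exp (z *\<^sub>C w) * y * exp (- (z *\<^sub>C w)))"
      using Cauchy_product_sums[OF f g] by simp
    moreover have "(\<Sum>i\<le>n. ?f i * ?g (n - i)) = z ^ n *\<^sub>C c n" for n
      unfolding c_def scaleC_sum_right
    proof (rule sum.cong[OF refl])
      fix i assume "i \<in> {..n}"
      then have "z ^ n = z ^ i * z ^ (n - i)" by (simp flip: power_add)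
      moreover have "(- (z *\<^sub>C w)) ^ (n - i) = z ^ (n - i) *\<^sub>C (- w) ^ (n - i)"
        using scaleC_power[of z "- w" "n - i"] by simp
      ultimately show "?f i * ?g (n - i)
          = z ^ n *\<^sub>C ((w ^ i /\<^sub>R fact i * y) * ((- w) ^ (n - i) /\<^sub>R fact (n - i)))"
        by (simp add: scaleC_power scaleR_scaleC mult_scaleC_left mult_scaleC_right scaleC_scaleC mult_ac)
    qed
    ultimately show ?thesis by simp
  qed
  have "c 1 = 0"
  proof (rule liouville_coefficient)
    fix R :: real assume R: "R \<ge> 0"
    \<comment> \<open>The terms are dominated by the Cauchy product of two real exponential series
      at \<open>R * norm w\<close>.\<close>
    let ?f = "\<lambda>n. ((R * norm w) ^ n /\<^sub>R fact n) * norm y" and ?g = "\<lambda>n. (R * norm w) ^ n /\<^sub>R fact n"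
    have nn: "?g n \<ge> 0" for n using R by simp
    have g: "summable (\<lambda>n. norm (?g n))" by (rule summable_norm_exp)
    have f: "summable (\<lambda>n. norm (?f n))"
      unfolding norm_mult by (intro summable_mult2 g)
    show "summable (\<lambda>n. R ^ n * norm (c n))"
    proof (rule summable_comparison_test[OF _ summable_Cauchy_product[OF f g]], intro exI allI impI)
      fix n
      have "norm (c n) \<le> (\<Sum>i\<le>n. (norm w ^ i /\<^sub>R fact i * norm y) * (norm w ^ (n - i) /\<^sub>R fact (n - i)))"
        unfolding c_def
      proof (rule sum_norm_le)
        fix i
        have "norm (w ^ i /\<^sub>R fact i * y) \<le> norm w ^ i /\<^sub>R fact i * norm y"
          by (rule order_trans[OF norm_mult_ineq])
             (auto intro!: mult_right_mono divide_right_mono norm_power_ineq simp: divide_inverse_commute[symmetric])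
        moreover have "norm ((- w) ^ (n - i) /\<^sub>R fact (n - i)) \<le> norm w ^ (n - i) /\<^sub>R fact (n - i)"
          using norm_power_ineq[of "- w" "n - i"]
          by (simp add: divide_right_mono divide_inverse_commute[symmetric])
        ultimately show "norm ((w ^ i /\<^sub>R fact i * y) * ((- w) ^ (n - i) /\<^sub>R fact (n - i)))
            \<le> (norm w ^ i /\<^sub>R fact i * norm y) * (norm w ^ (n - i) /\<^sub>R fact (n - i))"
          by (rule order_trans[OF norm_mult_ineq mult_mono]) auto
      qed
      then have "R ^ n * norm (c n)
          \<le> R ^ n * (\<Sum>i\<le>n. (norm w ^ i /\<^sub>R fact i * norm y) * (norm w ^ (n - i) /\<^sub>R fact (n - i)))"
        using R by (intro mult_left_mono) auto
      also have "\<dots> = (\<Sum>i\<le>n. ?f i * ?g (n - i))"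
        unfolding sum_distrib_left
      proof (rule sum.cong[OF refl])
        fix i assume "i \<in> {..n}"
        then have "R ^ n = R ^ i * R ^ (n - i)" by (simp flip: power_add)
        then show "R ^ n * ((norm w ^ i /\<^sub>R fact i * norm y) * (norm w ^ (n - i) /\<^sub>R fact (n - i)))
            = ?f i * ?g (n - i)"
          by (simp add: power_mult_distrib mult_ac)
      qed
      finally show "norm (R ^ n * norm (c n)) \<le> (\<Sum>i\<le>n. ?f i * ?g (n - i))"
        using R by simp
    qed
  next
    fix z :: complex
    define k where "k = z *\<^sub>C w - cnj z *\<^sub>C a"
    have k: "star k = - k"
      by (simp add: k_def w_def star_diff star_scaleC star_star)
    have kc: "k * (cnj z *\<^sub>C a) = (cnj z *\<^sub>C a) * k"
      using wa by (simp add: k_def algebra_simps mult_scaleC_left mult_scaleC_right scaleC_scaleC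
          scaleC_diff_right mult.commute)
    then have kc': "- (cnj z *\<^sub>C a) * - k = - k * - (cnj z *\<^sub>C a)"
      by (simp only: minus_mult_minus)
    \<comment> \<open>\<open>E\<close> commutes with \<open>y\<close> because \<open>a\<close> does,
      so the factors coming from \<open>cnj z a\<close> cancel across \<open>y\<close> and only
      \<open>exp k\<close> remains.\<close>
    define E where "E = exp (cnj z *\<^sub>C a)"
    have yE: "E * y = y * E"
      unfolding E_def using y
      by (intro exp_commute[symmetric]) (simp add: mult_scaleC_left mult_scaleC_right)
    have E: "E * exp (- (cnj z *\<^sub>C a)) = 1"
      unfolding E_def by (rule exp_minus_inverse)
    have "exp (z *\<^sub>C w) * y * exp (- (z *\<^sub>C w))
        = (exp k * E) * y * (exp (- (cnj z *\<^sub>C a)) * exp (- k))"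
      using exp_add_commuting[OF kc] exp_add_commuting[OF kc'] by (simp add: k_def E_def)
    also have "\<dots> = exp k * (E * y) * exp (- (cnj z *\<^sub>C a)) * exp (- k)"
      by (simp only: mult.assoc)
    also have "\<dots> = exp k * y * (E * exp (- (cnj z *\<^sub>C a))) * exp (- k)"
      by (simp only: yE mult.assoc)
    finally have eq: "exp (z *\<^sub>C w) * y * exp (- (z *\<^sub>C w)) = exp k * y * exp (- k)"
      by (simp only: E mult_1_right)
    have "norm (exp k * y * exp (- k)) \<le> norm (exp k) * norm y * norm (exp (- k))"
      by (intro order_trans[OF norm_mult_ineq] mult_right_mono norm_mult_ineq) auto
    also have "\<dots> = norm y"
      using norm_exp_skew[OF k] norm_exp_skew[of "- k"] k by simp
    finally show "norm (\<Sum>n. z ^ n *\<^sub>C c n) \<le> norm y"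
      using sums_unique[OF cp[of z]] eq by simp
  qed
  then show ?thesis by (simp add: c_def w_def)
qed

subsection \<open>Commutators from zero products\<close>

text \<open>
  With \<open>s\<close> a continuous approximation of \<open>sgn \<circ> f\<close> and \<open>k\<close> one of \<open>\<bar>f\<bar>\<close> that vanishes where
  \<open>\<bar>s\<bar> < 1\<close>, the hypothesis on \<open>b\<close> gives \<open>[s(h), b] k(h) = 0\<close>, hence
  \<open>[(s k)(h), b] = s(h) [k(h), b]\<close>.
\<close>

lemma norm_commutator_cfc_le_abs:
  fixes h :: "'a::cstar_algebra_1"
  assumes sa: "star h = h"
    and zero: "\<And>f g. continuous_on {-norm h..norm h} f \<Longrightarrow> continuous_on {-norm h..norm h} g \<Longrightarrow>
      (\<And>t. f t * g t = 0) \<Longrightarrow> cfc h f * b * cfc h g = 0"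
    and f: "continuous_on {-norm h..norm h} f"
  shows "norm (commutator (cfc h f) b) \<le> norm (commutator (cfc h (\<lambda>t. \<bar>f t\<bar>)) b)"
proof (rule field_le_epsilon)
  fix e :: real assume e: "e > 0"
  \<comment> \<open>Passing from \<open>f\<close> to \<open>u - v\<close> and from
    \<open>u + v\<close> to the absolute value of \<open>f\<close> costs
    \<open>2 * d * norm b\<close> each; the added 1 covers \<open>b = 0\<close>.\<close>
  define d where "d = e / (4 * (norm b + 1))"
  have nb: "norm b + 1 > 0" using norm_ge_zero[of b] by linarith
  have d: "d > 0" using e nb by (simp add: d_def)
  have "4 * d * norm b \<le> 4 * d * (norm b + 1)" using d by simp
  also have "\<dots> = e" using nb by (simp add: d_def field_simps)
  finally have dle: "4 * d * norm b \<le> e" .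
  \<comment> \<open>\<open>u\<close> and \<open>v\<close> are the positive and negative parts of
    \<open>f\<close> with a band of height \<open>d\<close> cut off, so \<open>s\<close> is 1 where
    \<open>u\<close> is nonzero and -1 where \<open>v\<close> is.\<close>
  define s u v where "s t = max (- 1) (min 1 (f t / d))"
    and "u t = max (f t - d) 0" and "v t = max (- f t - d) 0" for t
  have cs: "continuous_on {-norm h..norm h} s" and cu: "continuous_on {-norm h..norm h} u"
    and cv: "continuous_on {-norm h..norm h} v"
    unfolding s_def u_def v_def using d by (intro continuous_intros f; simp)+
  have su: "s t * u t = u t" and sv: "s t * v t = - v t" for t
    using d by (auto simp: s_def u_def v_def max_def min_def field_simps)
  define S U V where "S = cfc h s" and "U = cfc h u" and "V = cfc h v"
  have SU: "S * U = U"
    using cfc_mult[OF sa cs cu] unfolding su S_def[symmetric] U_def[symmetric] by (rule sym)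
  have neg: "cfc h (\<lambda>t. - v t) = - V"
    using cfc_diff[OF sa continuous_on_const cv, of 0] cfc_const[OF sa, of 0] by (simp add: V_def)
  have SV: "S * V = - V"
    using cfc_mult[OF sa cs cv] unfolding sv neg S_def[symmetric] V_def[symmetric] by (rule sym)
  have shift: "cfc h (\<lambda>t. s t - c) = S - of_real c" for c
    unfolding cfc_diff[OF sa cs continuous_on_const] cfc_const[OF sa] S_def ..
  \<comment> \<open>\<open>(s - 1) * u\<close> vanishes identically, so the zero product hypothesis
    applies; likewise \<open>(s + 1) * v\<close> below.\<close>
  have "cfc h (\<lambda>t. s t - 1) * b * U = 0"
    unfolding U_def by (rule zero) (auto intro!: continuous_intros cs cu simp: algebra_simps su)
  then have SbU: "S * b * U = b * U"
    unfolding shift by (simp add: algebra_simps)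
  have "cfc h (\<lambda>t. s t - (- 1)) * b * V = 0"
    unfolding V_def by (rule zero) (auto intro!: continuous_intros cs cv simp: algebra_simps sv)
  then have SbV: "S * b * V = - (b * V)"
    unfolding shift by (simp add: algebra_simps eq_neg_iff_add_eq_0)
  \<comment> \<open>Since \<open>S * (U + V) = U - V\<close> and
    \<open>S * b * (U + V) = b * (U - V)\<close>, the factor \<open>S\<close> can be pulled
    out.\<close>
  have "commutator (U - V) b = S * commutator (U + V) b"
    using SU SV SbU SbV unfolding commutator_def
    by (simp add: distrib_left distrib_right left_diff_distrib right_diff_distrib flip: mult.assoc)
  also have "norm \<dots> \<le> norm S * norm (commutator (U + V) b)"
    by (rule norm_mult_ineq)
  also have "\<dots> \<le> 1 * norm (commutator (U + V) b)"
    unfolding S_def by (intro mult_right_mono norm_cfc_le[OF sa cs]) (auto simp: s_def)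
  finally have le: "norm (commutator (U - V) b) \<le> norm (commutator (U + V) b)" by simp
  have UV: "U - V = cfc h (\<lambda>t. u t - v t)"
    unfolding U_def V_def by (rule cfc_diff[OF sa cu cv, symmetric])
  have UV': "cfc h (\<lambda>t. u t - - v t) = U + V"
    unfolding cfc_diff[OF sa cu continuous_on_minus[OF cv]] neg by (simp add: U_def)
  have close: "norm (commutator (cfc h p) b - commutator (cfc h q) b) \<le> 2 * d * norm b"
    if "continuous_on {-norm h..norm h} p" "continuous_on {-norm h..norm h} q"
      "\<And>t. \<bar>p t - q t\<bar> \<le> d" for p q
  proof -
    have "norm (commutator (cfc h p) b - commutator (cfc h q) b)
        = norm (commutator (cfc h (\<lambda>t. p t - q t)) b)"
      by (simp add: cfc_diff[OF sa that(1,2)] commutator_diff_left)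
    also have "\<dots> \<le> 2 * norm (cfc h (\<lambda>t. p t - q t)) * norm b"
      by (rule norm_commutator_le)
    also have "\<dots> \<le> 2 * d * norm b"
      by (intro mult_right_mono mult_left_mono norm_cfc_le[OF sa] continuous_intros that) auto
    finally show ?thesis .
  qed
  have c1: "norm (commutator (cfc h f) b - commutator (U - V) b) \<le> 2 * d * norm b"
    unfolding UV by (rule close) (use d in \<open>auto intro!: continuous_intros f cu cv simp: u_def v_def\<close>)
  have c2: "norm (commutator (U + V) b - commutator (cfc h (\<lambda>t. \<bar>f t\<bar>)) b) \<le> 2 * d * norm b"
    unfolding UV'[symmetric]
    by (rule close) (use d in \<open>auto intro!: continuous_intros f cu cv simp: u_def v_def\<close>)
  have "norm (commutator (cfc h f) b) \<le> norm (commutator (U - V) b) + 2 * d * norm b"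
    using c1 norm_triangle_ineq2[of "commutator (cfc h f) b" "commutator (U - V) b"] by linarith
  moreover have "norm (commutator (U + V) b) \<le> norm (commutator (cfc h (\<lambda>t. \<bar>f t\<bar>)) b) + 2 * d * norm b"
    using c2 norm_triangle_ineq2[of "commutator (U + V) b" "commutator (cfc h (\<lambda>t. \<bar>f t\<bar>)) b"] by linarith
  ultimately show "norm (commutator (cfc h f) b) \<le> norm (commutator (cfc h (\<lambda>t. \<bar>f t\<bar>)) b) + e"
    using le dle by linarith
qed

lemma commutator_eq_0_of_zero_products:
  fixes h :: "'a::cstar_algebra_1"
  assumes sa: "star h = h"
    and zero: "\<And>f g. continuous_on {-norm h..norm h} f \<Longrightarrow> continuous_on {-norm h..norm h} g \<Longrightarrow>
      (\<And>t. f t * g t = 0) \<Longrightarrow> cfc h f * b * cfc h g = 0"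
  shows "commutator h b = 0"
proof -
  \<comment> \<open>Stated for all \<open>f\<close> and \<open>K\<close>, since each halving step
    changes both.\<close>
  have bound: "norm (commutator (cfc h f) b) \<le> 2 * norm b * K / 2 ^ n"
    if "continuous_on {-norm h..norm h} f" "\<And>t. \<bar>t\<bar> \<le> norm h \<Longrightarrow> \<bar>f t\<bar> \<le> K" for f K n
    using that
  proof (induction n arbitrary: f K)
    case 0
    have "norm (commutator (cfc h f) b) \<le> 2 * norm (cfc h f) * norm b"
      by (rule norm_commutator_le)
    also have "\<dots> \<le> 2 * K * norm b"
      using norm_cfc_le[OF sa 0] by (intro mult_right_mono mult_left_mono) auto
    finally show ?case by (simp add: mult_ac)
  next
    case (Suc n)
    \<comment> \<open>Where the absolute value of \<open>f\<close> lies in \<open>[0, K]\<close>,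
      centering at \<open>K / 2\<close> halves the bound; the subtracted constant commutes with
      \<open>b\<close>.\<close>
    let ?g = "\<lambda>t. \<bar>f t\<bar> - K / 2"
    have abs: "continuous_on {-norm h..norm h} (\<lambda>t. \<bar>f t\<bar>)"
      by (intro continuous_intros Suc.prems)
    have "cfc h ?g = cfc h (\<lambda>t. \<bar>f t\<bar>) - of_real (K / 2)"
      unfolding cfc_diff[OF sa abs continuous_on_const] cfc_const[OF sa] ..
    then have "commutator (cfc h (\<lambda>t. \<bar>f t\<bar>)) b = commutator (cfc h ?g) b"
      by (simp add: commutator_diff_left) (simp add: commutator_def of_real_def)
    then have "norm (commutator (cfc h f) b) \<le> norm (commutator (cfc h ?g) b)"
      using norm_commutator_cfc_le_abs[OF sa _ Suc.prems(1), of b] zero by metis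
    also have "\<dots> \<le> 2 * norm b * (K / 2) / 2 ^ n"
    proof (rule Suc.IH)
      show "continuous_on {-norm h..norm h} ?g" by (intro continuous_intros abs)
      show "\<bar>?g t\<bar> \<le> K / 2" if "\<bar>t\<bar> \<le> norm h" for t
        using Suc.prems(2)[OF that] by (simp add: abs_if)
    qed
    finally show ?case by simp
  qed
  have "norm (commutator h b) \<le> 2 * norm b * norm h / 2 ^ n" for n
    using bound[of "\<lambda>t. t" "norm h" n] cfc_id[OF sa] by simp
  moreover have "(\<lambda>n. 2 * norm b * norm h / 2 ^ n) \<longlonglongrightarrow> 0"
    by (rule LIMSEQ_divide_realpow_zero) simp
  ultimately have "norm (commutator h b) \<le> 0"
    by (intro tendsto_lowerbound[OF _ always_eventually]) auto
  then show ?thesis by simp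
qed

text \<open>
  The identity \<open>g d = c g\<close> for \<open>d = [b, f y g]\<close> and \<open>c = g b f y\<close> turns a resolvent of \<open>d\<close> into a
  right resolvent of \<open>c\<close>, which is two-sided when \<open>c\<close> is self-adjoint.
\<close>

lemma zero_product_of_spectrum_commutator:
  fixes a b f g :: "'a::cstar_algebra_1"
  assumes hyp: "\<And>x. spectrum (commutator b x) \<subseteq> spectrum (commutator a x)"
    and f: "f * a = a * f" and g: "g * a = a * g" and gf: "g * f = 0"
  shows "g * b * f = 0"
proof -
  \<comment> \<open>This makes \<open>c\<close> the product of \<open>g * b * f\<close> with its
    adjoint, so \<open>norm c\<close> is the square of \<open>norm (g * b * f)\<close>.\<close>
  define y where "y = star (g * b * f)"
  define v where "v = f * y * g"
  define d where "d = commutator b v"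
  define c where "c = g * b * f * y"
  have "a * v = f * (a * y) * g"
    using f unfolding v_def by (metis mult.assoc)
  moreover have "v * a = f * (y * a) * g"
    using g unfolding v_def by (metis mult.assoc)
  ultimately have "commutator a v = f * (a * y - y * a) * g"
    by (simp add: commutator_def left_diff_distrib right_diff_distrib)
  then have "commutator a v * commutator a v
      = f * (a * y - y * a) * (g * f) * ((a * y - y * a) * g)"
    by (simp only: mult.assoc)
  then have "spectrum (commutator a v) \<subseteq> {0}"
    using gf by (intro spectrum_square_zero) simp
  then have d: "spectrum d \<subseteq> {0}" using hyp unfolding d_def by blast
  have "g * v = 0" using gf by (simp add: v_def flip: mult.assoc)
  then have gd: "g * d = c * g"
    by (simp add: d_def commutator_def right_diff_distrib flip: mult.assoc)
       (simp add: c_def v_def mult.assoc)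
  have sac: "star c = c" by (simp add: c_def y_def star_mult star_star mult.assoc)
  have "z = 0" if z: "z \<in> spectrum c" for z
  proof (rule ccontr)
    assume "z \<noteq> 0"
    then have "z \<notin> spectrum d" using d by blast
    then obtain D where D: "(z *\<^sub>C 1 - d) * D = 1"
      unfolding spectrum_def invertible_element_def by blast
    have "(z *\<^sub>C 1 - c) * g = g * (z *\<^sub>C 1 - d)"
      using gd by (simp add: left_diff_distrib right_diff_distrib mult_scaleC_left mult_scaleC_right)
    \<comment> \<open>\<open>g\<close> intertwines \<open>d\<close> and \<open>c\<close>, so
      \<open>g * D\<close> solves the equation with right side \<open>g\<close>. Multiplying by
      \<open>b * f * y\<close> gives right side \<open>c\<close>, and adding 1 to the solution gives
      right side \<open>z\<close>.\<close>
    then have "(z *\<^sub>C 1 - c) * (g * D) = g"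
      using D by (metis mult.assoc mult.right_neutral)
    then have "(z *\<^sub>C 1 - c) * (g * D * (b * f * y)) = c"
      by (metis c_def mult.assoc)
    then have "(z *\<^sub>C 1 - c) * (1 + g * D * (b * f * y)) = z *\<^sub>C 1"
      by (simp add: distrib_left)
    then have r: "(z *\<^sub>C 1 - c) * (inverse z *\<^sub>C (1 + g * D * (b * f * y))) = 1"
      using \<open>z \<noteq> 0\<close> by (simp add: mult_scaleC_right scaleC_scaleC)
    have "cnj z = z"
      using spectrum_selfadjoint_real[OF sac z] by (simp add: complex_eq_iff)
    then have st: "star (z *\<^sub>C 1 - c) = z *\<^sub>C 1 - c"
      using sac by (simp add: star_diff star_scaleC)
    \<comment> \<open>\<open>X\<close> is self-adjoint, so the adjoint of its right inverse is a
      left inverse, and the two coincide.\<close>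
    define X Y where "X = z *\<^sub>C 1 - c" and "Y = inverse z *\<^sub>C (1 + g * D * (b * f * y))"
    have XY: "X * Y = 1" using r by (simp only: X_def Y_def)
    have "star Y * X = star (X * Y)" by (simp only: star_mult) (simp only: st X_def)
    then have YX: "star Y * X = 1" unfolding XY by simp
    have "star Y = star Y * (X * Y)" using XY by simp
    also have "\<dots> = Y" using YX by (simp flip: mult.assoc)
    finally have "invertible_element X"
      unfolding invertible_element_def using XY YX by auto
    then show False using z by (simp add: spectrum_def X_def)
  qed
  moreover obtain z where "z \<in> spectrum c" "cmod z = norm c"
    using selfadjoint_spectral_radius[OF sac] by blast
  ultimately have "norm c = 0" by force
  moreover have "c = (g * b * f) * star (g * b * f)" by (simp add: c_def y_def)
  ultimately show ?thesis using cstar_identity'[of "g * b * f"] by simp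
qed

section \<open>Deduction of the theorem\<close>

lemma commute_selfadjoint_of_spectrum_commutator:
  fixes a b h :: "'a::cstar_algebra_1"
  assumes hyp: "\<And>x. spectrum (commutator b x) \<subseteq> spectrum (commutator a x)"
    and sa: "star h = h" and ha: "a * h = h * a"
  shows "h * b = b * h"
proof -
  have "commutator h b = 0"
  proof (rule commutator_eq_0_of_zero_products[OF sa])
    fix f g :: "real \<Rightarrow> real"
    assume f: "continuous_on {-norm h..norm h} f" and g: "continuous_on {-norm h..norm h} g"
      and fg: "\<And>t. f t * g t = 0"
    have "cfc h f * cfc h g = 0"
      using cfc_mult[OF sa f g] cfc_const[OF sa, of 0] by (simp add: fg)
    \<comment> \<open>Functions of \<open>h\<close> commute with \<open>a\<close> because
      \<open>h\<close> does. The zero product lemma is used with the roles of its \<open>f\<close>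
      and \<open>g\<close> exchanged.\<close>
    then show "cfc h f * b * cfc h g = 0"
      using cfc_commute[OF sa f ha] cfc_commute[OF sa g ha]
      by (intro zero_product_of_spectrum_commutator[OF hyp]) auto
  qed
  then show ?thesis by (simp add: commutator_def)
qed

theorem theorem5p1:
  fixes a b :: "'a::cstar_algebra_1"
  assumes "normal_element a"
    and "\<And>x. spectrum (commutator b x) \<subseteq> spectrum (commutator a x)"
  shows "b \<in> bicommutant {a}"
proof -
  have "b * y = y * b" if "y * a = a * y" for y
  proof -
    \<comment> \<open>Taking adjoints in Fuglede's theorem shows that \<open>star y\<close> commutes
      with \<open>a\<close>, hence so do the real and imaginary parts of \<open>y\<close>.\<close>
    have "star (star a * y) = star (y * star a)"
      using fuglede[OF assms(1)] that by simp
    then have sy: "star y * a = a * star y" by (simp add: star_mult star_star)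
    have p: "(y + star y) * b = b * (y + star y)"
      by (rule commute_selfadjoint_of_spectrum_commutator[OF assms(2)])
         (use that sy in \<open>auto simp: star_add star_star algebra_simps\<close>)
    \<comment> \<open>The factor \<open>i\<close> makes the skew-adjoint difference self-adjoint;
      multiplication by \<open>- i\<close> removes it afterwards.\<close>
    have "(\<i> *\<^sub>C (y - star y)) * b = b * (\<i> *\<^sub>C (y - star y))"
      by (rule commute_selfadjoint_of_spectrum_commutator[OF assms(2)])
         (use that sy in \<open>auto simp: star_diff star_scaleC star_star scaleC_diff_right
            mult_scaleC_left mult_scaleC_right algebra_simps\<close>)
    then have "\<i> *\<^sub>C ((y - star y) * b) = \<i> *\<^sub>C (b * (y - star y))"
      by (simp add: mult_scaleC_left mult_scaleC_right)
    then have "(- \<i>) *\<^sub>C \<i> *\<^sub>C ((y - star y) * b) = (- \<i>) *\<^sub>C \<i> *\<^sub>C (b * (y - star y))"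
      by (rule arg_cong)
    then have m: "(y - star y) * b = b * (y - star y)" by (simp only: scaleC_scaleC) simp
    have "2 *\<^sub>R (y * b) = (y + star y) * b + (y - star y) * b"
      by (simp add: algebra_simps scaleR_2)
    also have "\<dots> = 2 *\<^sub>R (b * y)"
      unfolding p m by (simp add: algebra_simps scaleR_2)
    finally show ?thesis by simp
  qed
  then show ?thesis by (auto simp: bicommutant_def commutant_def)
qed

end
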